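(* Let $C_\varphi$ be a bounded composition operator on $\mathcal{H}(\beta,\Lambda)$. Then: (1) If $\varphi(z)=z+b$ with $b\in\mathbb{C}$, then $C_\varphi$ is complex symmetric. More precisely, $C_\varphi$ is $J_\xi$-symmetric for every composition conjugation $J_\xi$ where $\xi(z)=z+ci$, $c\in\mathbb{R}$. (2) If $\varphi(z)=az+b$ with $b\in\mathbb{C}$ and $a\in\mathcal{R}_1(\Lambda)$, then $C_\varphi$ is not complex symmetric (with respect to any conjugation). (3) If $\lambda_1=0$ and $\varphi(z)=b$ is constant, then $C_b$ is complex symmetric.
   Context: $\mathbb{N}=\{1,2,\dots\}$. $\Lambda=(\lambda_n)_{n\ge1}$ is a strictly increasing sequence of non-negative real numbers tending to $\infty$ with $L:=\limsup_{n\to\infty}\frac{\log n}{\lambda_n}<\infty$. $\beta=(\beta_n)_{n\ge1}$ is a sequence of positive real numbers with $\beta_*:=\liminf_{n\to\infty}\frac{\log\beta_n}{\lambda_n}\neq\pm\infty$. For $r\in\mathbb{R}$, $\mathbb{C}_r=\{z\in\mathbb{C}:\operatorname{Re}(z)>r\}$. $\mathcal{H}(\beta,\Lambda)$ is the space of Dirichlet series $f(z)=\sum_{n=1}^\infty a_ne^{-\lambda_nz}$ with $\sum_{n=1}^\infty|a_n|^2\beta_n^2<\infty$; such series converge to holomorphic functions on $\mathbb{C}_{L/2-\beta_*}$, their coefficients are uniquely determined by $f$, and $\mathcal{H}(\beta,\Lambda)$ is a Hilbert space with inner product $\langle f,g\rangle=\sum_{n}a_n\overline{b_n}\beta_n^2$.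 $C_\varphi f=f\circ\varphi$; "$C_\varphi$ is a bounded composition operator on $\mathcal{H}(\beta,\Lambda)$" means that $\varphi$ is a holomorphic self-map of $\mathbb{C}_{L/2-\beta_*}$ and $C_\varphi$ maps $\mathcal{H}(\beta,\Lambda)$ into itself boundedly. $\mathcal{R}(\Lambda)=\{r\in[1,\infty):\forall n\in\mathbb{N}\ \exists m\ge n,\ r\lambda_n=\lambda_m\}$ and $\mathcal{R}_1(\Lambda)=\mathcal{R}(\Lambda)\setminus\{1\}$. A conjugation on a complex Hilbert space $\mathcal{H}$ is a map $\mathcal{C}:\mathcal{H}\to\mathcal{H}$ that is anti-linear, satisfies $\|\mathcal{C}x\|=\|x\|$ for all $x$, and $\mathcal{C}\mathcal{C}=I$. A bounded operator $T$ is $\mathcal{C}$-symmetric if $\mathcal{C}T\mathcal{C}=T^*$, and complex symmetric if it is $\mathcal{C}$-symmetric for some conjugation $\mathcal{C}$. For an analytic $\xi:\mathbb{C}_{L/2-\beta_*}\to\mathbb{C}_{L/2-\beta_*}$, $J_\xi f(z)=\overline{f(\overline{\xi(z)})}$ for $f\in\mathcal{H}(\beta,\Lambda)$; if $J_\xi$ is a conjugation it is called a composition conjugation. *)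

theory Defs
  imports "HOL-Analysis.Analysis"
begin

(* Sequences are indexed from 0: \<Lambda> n and \<beta> n are the (n+1)-st frequency and weight.
   Hence log(n+1) below, and the first frequency is \<Lambda> 0. *)

definition freq_growth :: "(nat \<Rightarrow> real) \<Rightarrow> ereal" where
  "freq_growth \<Lambda> = limsup (\<lambda>n. ereal (ln (real (Suc n)) / \<Lambda> n))"

definition weight_growth :: "(nat \<Rightarrow> real) \<Rightarrow> (nat \<Rightarrow> real) \<Rightarrow> ereal" where
  "weight_growth \<beta> \<Lambda> = liminf (\<lambda>n. ereal (ln (\<beta> n) / \<Lambda> n))"

definition half_plane :: "real \<Rightarrow> complex set" where
  "half_plane r = {z. Re z > r}"

(* Only meaningful when freq_growth and weight_growth are finite. *)
definition dom_H :: "(nat \<Rightarrow> real) \<Rightarrow> (nat \<Rightarrow> real) \<Rightarrow> complex set" where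
  "dom_H \<beta> \<Lambda> = half_plane (real_of_ereal (freq_growth \<Lambda>) / 2 - real_of_ereal (weight_growth \<beta> \<Lambda>))"

(* Functions on the half-plane are represented by total functions that vanish off it,
   so that equality of functions on the half-plane is equality in HOL. *)
definition restr_H :: "(nat \<Rightarrow> real) \<Rightarrow> (nat \<Rightarrow> real) \<Rightarrow> (complex \<Rightarrow> complex) \<Rightarrow> complex \<Rightarrow> complex" where
  "restr_H \<beta> \<Lambda> g = (\<lambda>z. if z \<in> dom_H \<beta> \<Lambda> then g z else 0)"

definition dirichlet_series :: "(nat \<Rightarrow> real) \<Rightarrow> (nat \<Rightarrow> complex) \<Rightarrow> complex \<Rightarrow> complex" where
  "dirichlet_series \<Lambda> a z = (\<Sum>n. a n * exp (- (of_real (\<Lambda> n) * z)))"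

definition is_coeffs ::
  "(nat \<Rightarrow> real) \<Rightarrow> (nat \<Rightarrow> real) \<Rightarrow> (complex \<Rightarrow> complex) \<Rightarrow> (nat \<Rightarrow> complex) \<Rightarrow> bool" where
  "is_coeffs \<beta> \<Lambda> f a \<longleftrightarrow>
     summable (\<lambda>n. (cmod (a n))\<^sup>2 * (\<beta> n)\<^sup>2) \<and> f = restr_H \<beta> \<Lambda> (dirichlet_series \<Lambda> a)"

definition space_H :: "(nat \<Rightarrow> real) \<Rightarrow> (nat \<Rightarrow> real) \<Rightarrow> (complex \<Rightarrow> complex) set" where
  "space_H \<beta> \<Lambda> = {f. \<exists>a. is_coeffs \<beta> \<Lambda> f a}"

definition coeffs_H ::
  "(nat \<Rightarrow> real) \<Rightarrow> (nat \<Rightarrow> real) \<Rightarrow> (complex \<Rightarrow> complex) \<Rightarrow> nat \<Rightarrow> complex" where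
  "coeffs_H \<beta> \<Lambda> f = (THE a. is_coeffs \<beta> \<Lambda> f a)"

definition inner_H ::
  "(nat \<Rightarrow> real) \<Rightarrow> (nat \<Rightarrow> real) \<Rightarrow> (complex \<Rightarrow> complex) \<Rightarrow> (complex \<Rightarrow> complex) \<Rightarrow> complex" where
  "inner_H \<beta> \<Lambda> f g =
     (\<Sum>n. coeffs_H \<beta> \<Lambda> f n * cnj (coeffs_H \<beta> \<Lambda> g n) * of_real ((\<beta> n)\<^sup>2))"

definition norm_H :: "(nat \<Rightarrow> real) \<Rightarrow> (nat \<Rightarrow> real) \<Rightarrow> (complex \<Rightarrow> complex) \<Rightarrow> real" where
  "norm_H \<beta> \<Lambda> f = sqrt (Re (inner_H \<beta> \<Lambda> f f))"

definition comp_op ::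
  "(nat \<Rightarrow> real) \<Rightarrow> (nat \<Rightarrow> real) \<Rightarrow> (complex \<Rightarrow> complex) \<Rightarrow> (complex \<Rightarrow> complex) \<Rightarrow> complex \<Rightarrow> complex" where
  "comp_op \<beta> \<Lambda> \<phi> f = restr_H \<beta> \<Lambda> (f \<circ> \<phi>)"

definition holo_self_map :: "(nat \<Rightarrow> real) \<Rightarrow> (nat \<Rightarrow> real) \<Rightarrow> (complex \<Rightarrow> complex) \<Rightarrow> bool" where
  "holo_self_map \<beta> \<Lambda> \<phi> \<longleftrightarrow>
     \<phi> holomorphic_on dom_H \<beta> \<Lambda> \<and> \<phi> ` dom_H \<beta> \<Lambda> \<subseteq> dom_H \<beta> \<Lambda>"

definition bounded_comp_op :: "(nat \<Rightarrow> real) \<Rightarrow> (nat \<Rightarrow> real) \<Rightarrow> (complex \<Rightarrow> complex) \<Rightarrow> bool" where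
  "bounded_comp_op \<beta> \<Lambda> \<phi> \<longleftrightarrow>
     holo_self_map \<beta> \<Lambda> \<phi> \<and>
     comp_op \<beta> \<Lambda> \<phi> ` space_H \<beta> \<Lambda> \<subseteq> space_H \<beta> \<Lambda> \<and>
     (\<exists>M. \<forall>f\<in>space_H \<beta> \<Lambda>. norm_H \<beta> \<Lambda> (comp_op \<beta> \<Lambda> \<phi> f) \<le> M * norm_H \<beta> \<Lambda> f)"

definition freq_ratios :: "(nat \<Rightarrow> real) \<Rightarrow> real set" where
  "freq_ratios \<Lambda> = {r. 1 \<le> r \<and> (\<forall>n. \<exists>m\<ge>n. r * \<Lambda> n = \<Lambda> m)}"

definition freq_ratios1 :: "(nat \<Rightarrow> real) \<Rightarrow> real set" where
  "freq_ratios1 \<Lambda> = freq_ratios \<Lambda> - {1}"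

(* Operators on the Hilbert space are total maps of which only the values on space_H matter. *)

definition conjugation ::
  "(nat \<Rightarrow> real) \<Rightarrow> (nat \<Rightarrow> real) \<Rightarrow> ((complex \<Rightarrow> complex) \<Rightarrow> complex \<Rightarrow> complex) \<Rightarrow> bool" where
  "conjugation \<beta> \<Lambda> C \<longleftrightarrow>
     C ` space_H \<beta> \<Lambda> \<subseteq> space_H \<beta> \<Lambda> \<and>
     (\<forall>f\<in>space_H \<beta> \<Lambda>. \<forall>g\<in>space_H \<beta> \<Lambda>. \<forall>s t.
        C (\<lambda>z. s * f z + t * g z) = (\<lambda>z. cnj s * C f z + cnj t * C g z)) \<and>
     (\<forall>f\<in>space_H \<beta> \<Lambda>. norm_H \<beta> \<Lambda> (C f) = norm_H \<beta> \<Lambda> f) \<and>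
     (\<forall>f\<in>space_H \<beta> \<Lambda>. C (C f) = f)"

(* For a bounded operator T, the description below is satisfied by exactly one h (Riesz). *)
definition adjoint_H ::
  "(nat \<Rightarrow> real) \<Rightarrow> (nat \<Rightarrow> real) \<Rightarrow> ((complex \<Rightarrow> complex) \<Rightarrow> complex \<Rightarrow> complex) \<Rightarrow>
     (complex \<Rightarrow> complex) \<Rightarrow> complex \<Rightarrow> complex" where
  "adjoint_H \<beta> \<Lambda> T g =
     (THE h. h \<in> space_H \<beta> \<Lambda> \<and> (\<forall>f\<in>space_H \<beta> \<Lambda>. inner_H \<beta> \<Lambda> (T f) g = inner_H \<beta> \<Lambda> f h))"

definition symmetric_wrt ::
  "(nat \<Rightarrow> real) \<Rightarrow> (nat \<Rightarrow> real) \<Rightarrow> ((complex \<Rightarrow> complex) \<Rightarrow> complex \<Rightarrow> complex) \<Rightarrow>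
     ((complex \<Rightarrow> complex) \<Rightarrow> complex \<Rightarrow> complex) \<Rightarrow> bool" where
  "symmetric_wrt \<beta> \<Lambda> C T \<longleftrightarrow> (\<forall>f\<in>space_H \<beta> \<Lambda>. C (T (C f)) = adjoint_H \<beta> \<Lambda> T f)"

definition complex_symmetric ::
  "(nat \<Rightarrow> real) \<Rightarrow> (nat \<Rightarrow> real) \<Rightarrow> ((complex \<Rightarrow> complex) \<Rightarrow> complex \<Rightarrow> complex) \<Rightarrow> bool" where
  "complex_symmetric \<beta> \<Lambda> T \<longleftrightarrow> (\<exists>C. conjugation \<beta> \<Lambda> C \<and> symmetric_wrt \<beta> \<Lambda> C T)"

definition J_op ::
  "(nat \<Rightarrow> real) \<Rightarrow> (nat \<Rightarrow> real) \<Rightarrow> (complex \<Rightarrow> complex) \<Rightarrow> (complex \<Rightarrow> complex) \<Rightarrow> complex \<Rightarrow> complex" where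
  "J_op \<beta> \<Lambda> \<xi> f = restr_H \<beta> \<Lambda> (\<lambda>z. cnj (f (cnj (\<xi> z))))"

definition composition_conjugation ::
  "(nat \<Rightarrow> real) \<Rightarrow> (nat \<Rightarrow> real) \<Rightarrow> (complex \<Rightarrow> complex) \<Rightarrow> bool" where
  "composition_conjugation \<beta> \<Lambda> \<xi> \<longleftrightarrow> holo_self_map \<beta> \<Lambda> \<xi> \<and> conjugation \<beta> \<Lambda> (J_op \<beta> \<Lambda> \<xi>)"

end

theory Submission imports Defs begin

text \<open>Coefficients identify the Hilbert space of Dirichlet series with a weighted \<open>\<ell>\<^sup>2\<close> space, and
  the proof consists of elementary Hilbert space geometry there. The identification rests on two
  analytic facts. The growth conditions on frequencies and weights make evaluation at each point
  of the half-plane the inner product with a square-summable sequence (\<open>kern_l2\<close>), so every series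
  converges absolutely there. An absolutely convergent Dirichlet series that vanishes far to the
  right has zero coefficients, because after division by its leading exponential everything else
  decays (\<open>dirichlet_series_zero_imp_coeffs_zero\<close>).

  A translation multiplies the \<open>n\<close>-th coefficient by \<open>exp (- \<Lambda> n * b)\<close>, so it is a normal diagonal
  operator. A composition conjugation by an imaginary translation conjugates the coefficients and
  multiplies them by unimodular factors. These factors cancel, and the diagonal entries get
  conjugated, which is what the adjoint does (\<open>translation_symmetric\<close>).

  If \<open>C T C = T*\<close> for a conjugation \<open>C\<close> and \<open>T\<close> is injective, then so is \<open>T*\<close>. A dilation by \<open>a > 1\<close>,
  possibly composed with a translation, is injective, but its range consists of series with
  frequencies in \<open>a \<Lambda>\<close>. A frequency missing from that set yields an exponential in the kernel of the adjoint
  (\<open>dilation_not_complex_symmetric\<close>).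

  A constant symbol \<open>b\<close> gives the rank-one operator \<open>f \<mapsto> \<langle>f, v\<rangle> u\<close>, where \<open>u = 1\<close> and \<open>v\<close> is the
  reproducing kernel at \<open>b\<close>. Its adjoint is \<open>f \<mapsto> \<langle>f, u\<rangle> v\<close>, so it suffices to find a conjugation
  that exchanges \<open>u / \<parallel>u\<parallel>\<close> and \<open>v / \<parallel>v\<parallel>\<close>. Entrywise conjugation with suitable phases fixes both
  vectors, and the reflection in the hyperplane orthogonal to \<open>u / \<parallel>u\<parallel> - v / \<parallel>v\<parallel>\<close> exchanges
  them, since their inner product is real. The two maps commute, and their composite is the
  required conjugation (\<open>constant_complex_symmetric\<close>).\<close>

section \<open>Square-summable coefficient sequences\<close>

definition l2_weighted :: "(nat \<Rightarrow> real) \<Rightarrow> (nat \<Rightarrow> complex) set" where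
  "l2_weighted \<beta> = {a. summable (\<lambda>n. (cmod (a n))\<^sup>2 * (\<beta> n)\<^sup>2)}"

definition ip :: "(nat \<Rightarrow> real) \<Rightarrow> (nat \<Rightarrow> complex) \<Rightarrow> (nat \<Rightarrow> complex) \<Rightarrow> complex" where
  "ip \<beta> a b = (\<Sum>n. a n * cnj (b n) * of_real ((\<beta> n)\<^sup>2))"

definition unit_seq :: "nat \<Rightarrow> nat \<Rightarrow> complex" where
  "unit_seq k = (\<lambda>n. if n = k then 1 else 0)"

lemma l2_summable: "a \<in> l2_weighted \<beta> \<Longrightarrow> summable (\<lambda>n. (cmod (a n))\<^sup>2 * (\<beta> n)\<^sup>2)"
  by (simp add: l2_weighted_def)

lemma l2_if_bounded_multiple:
  assumes "a \<in> l2_weighted \<beta>" and "\<And>n. cmod (b n) \<le> K * cmod (a n)"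
  shows "b \<in> l2_weighted \<beta>"
proof -
  have "summable (\<lambda>n. K\<^sup>2 * ((cmod (a n))\<^sup>2 * (\<beta> n)\<^sup>2))"
    using l2_summable[OF assms(1)] by (rule summable_mult)
  moreover have "norm ((cmod (b n))\<^sup>2 * (\<beta> n)\<^sup>2) \<le> K\<^sup>2 * ((cmod (a n))\<^sup>2 * (\<beta> n)\<^sup>2)" for n
  proof -
    have "(cmod (b n))\<^sup>2 \<le> (K * cmod (a n))\<^sup>2"
      using assms(2)[of n] by (intro power_mono) auto
    then have "(cmod (b n))\<^sup>2 * (\<beta> n)\<^sup>2 \<le> (K * cmod (a n))\<^sup>2 * (\<beta> n)\<^sup>2"
      by (rule mult_right_mono) simp
    then show ?thesis by (simp add: power_mult_distrib mult.assoc)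
  qed
  ultimately show ?thesis
    unfolding l2_weighted_def mem_Collect_eq by (rule summable_comparison_test'[where N = 0]) 
qed

lemma l2_add:
  assumes "a \<in> l2_weighted \<beta>" and "b \<in> l2_weighted \<beta>"
  shows "(\<lambda>n. a n + b n) \<in> l2_weighted \<beta>"
proof -
  have "summable (\<lambda>n. 2 * ((cmod (a n))\<^sup>2 * (\<beta> n)\<^sup>2) + 2 * ((cmod (b n))\<^sup>2 * (\<beta> n)\<^sup>2))"
    using assms[THEN l2_summable] by (intro summable_add summable_mult)
  moreover have "norm ((cmod (a n + b n))\<^sup>2 * (\<beta> n)\<^sup>2)
      \<le> 2 * ((cmod (a n))\<^sup>2 * (\<beta> n)\<^sup>2) + 2 * ((cmod (b n))\<^sup>2 * (\<beta> n)\<^sup>2)" for n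
  proof -
    have "(cmod (a n + b n))\<^sup>2 \<le> (cmod (a n) + cmod (b n))\<^sup>2"
      by (intro power_mono norm_triangle_ineq) auto
    also have "\<dots> \<le> 2 * (cmod (a n))\<^sup>2 + 2 * (cmod (b n))\<^sup>2"
      using zero_le_power2[of "cmod (a n) - cmod (b n)"] by (simp add: power2_eq_square algebra_simps)
    finally have "(cmod (a n + b n))\<^sup>2 * (\<beta> n)\<^sup>2 \<le> (2 * (cmod (a n))\<^sup>2 + 2 * (cmod (b n))\<^sup>2) * (\<beta> n)\<^sup>2"
      by (rule mult_right_mono) simp
    then show ?thesis by (simp add: algebra_simps)
  qed
  ultimately show ?thesis
    unfolding l2_weighted_def mem_Collect_eq by (rule summable_comparison_test'[where N = 0])
qed

lemma l2_mult: "a \<in> l2_weighted \<beta> \<Longrightarrow> (\<lambda>n. s * a n) \<in> l2_weighted \<beta>"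
  by (rule l2_if_bounded_multiple[where K = "cmod s"]) (auto simp: norm_mult)

lemma l2_comb:
  "a \<in> l2_weighted \<beta> \<Longrightarrow> b \<in> l2_weighted \<beta> \<Longrightarrow> (\<lambda>n. s * a n + t * b n) \<in> l2_weighted \<beta>"
  by (intro l2_add l2_mult)

lemma l2_zero: "(\<lambda>_. 0) \<in> l2_weighted \<beta>"
  by (simp add: l2_weighted_def)

lemma l2_unit_seq: "unit_seq k \<in> l2_weighted \<beta>"
  unfolding l2_weighted_def mem_Collect_eq
  by (rule summable_finite[of "{k}"]) (auto simp: unit_seq_def)

lemma ip_abs_summable:
  assumes "a \<in> l2_weighted \<beta>" and "b \<in> l2_weighted \<beta>"
  shows "summable (\<lambda>n. cmod (a n * cnj (b n) * of_real ((\<beta> n)\<^sup>2)))"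
proof (rule summable_comparison_test'[where N = 0])
  show "summable (\<lambda>n. (cmod (a n))\<^sup>2 * (\<beta> n)\<^sup>2 + (cmod (b n))\<^sup>2 * (\<beta> n)\<^sup>2)"
    using assms[THEN l2_summable] by (rule summable_add)
  fix n :: nat
  have "2 * (cmod (a n) * cmod (b n)) \<le> (cmod (a n))\<^sup>2 + (cmod (b n))\<^sup>2"
    using zero_le_power2[of "cmod (a n) - cmod (b n)"] by (simp add: power2_eq_square algebra_simps)
  moreover have "0 \<le> cmod (a n) * cmod (b n)"
    by simp
  ultimately have "cmod (a n) * cmod (b n) \<le> (cmod (a n))\<^sup>2 + (cmod (b n))\<^sup>2"
    by linarith
  then have "(cmod (a n) * cmod (b n)) * (\<beta> n)\<^sup>2 \<le> ((cmod (a n))\<^sup>2 + (cmod (b n))\<^sup>2) * (\<beta> n)\<^sup>2"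
    by (rule mult_right_mono) simp
  then show "norm (cmod (a n * cnj (b n) * of_real ((\<beta> n)\<^sup>2)))
      \<le> (cmod (a n))\<^sup>2 * (\<beta> n)\<^sup>2 + (cmod (b n))\<^sup>2 * (\<beta> n)\<^sup>2"
    by (simp add: norm_mult norm_power algebra_simps)
qed

lemmas ip_summable = summable_norm_cancel[OF ip_abs_summable]

lemma ip_comb_left:
  assumes "a \<in> l2_weighted \<beta>" and "b \<in> l2_weighted \<beta>" and "c \<in> l2_weighted \<beta>"
  shows "ip \<beta> (\<lambda>n. s * a n + t * b n) c = s * ip \<beta> a c + t * ip \<beta> b c"
proof -
  have "ip \<beta> (\<lambda>n. s * a n + t * b n) c =
      (\<Sum>n. s * (a n * cnj (c n) * of_real ((\<beta> n)\<^sup>2)) + t * (b n * cnj (c n) * of_real ((\<beta> n)\<^sup>2)))"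
    unfolding ip_def by (simp add: algebra_simps)
  also have "\<dots> = (\<Sum>n. s * (a n * cnj (c n) * of_real ((\<beta> n)\<^sup>2)))
      + (\<Sum>n. t * (b n * cnj (c n) * of_real ((\<beta> n)\<^sup>2)))"
    using assms by (intro suminf_add[symmetric] summable_mult ip_summable)
  also have "\<dots> = s * ip \<beta> a c + t * ip \<beta> b c"
    unfolding ip_def using assms by (simp add: suminf_mult ip_summable del: of_real_power)
  finally show ?thesis .
qed

lemma ip_cnj:
  assumes "a \<in> l2_weighted \<beta>" and "b \<in> l2_weighted \<beta>"
  shows "cnj (ip \<beta> a b) = ip \<beta> b a"
proof -
  have "(\<lambda>n. cnj (a n * cnj (b n) * of_real ((\<beta> n)\<^sup>2))) sums cnj (ip \<beta> a b)"
    unfolding sums_cnj ip_def using ip_summable[OF assms] by (rule summable_sums)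
  moreover have "cnj (a n * cnj (b n) * of_real ((\<beta> n)\<^sup>2)) = b n * cnj (a n) * of_real ((\<beta> n)\<^sup>2)" for n
    by simp
  ultimately have "(\<lambda>n. b n * cnj (a n) * of_real ((\<beta> n)\<^sup>2)) sums cnj (ip \<beta> a b)"
    by (simp only:)
  then show ?thesis
    unfolding ip_def[of \<beta> b a] by (simp only: sums_iff)
qed

lemma ip_comb_right:
  assumes "a \<in> l2_weighted \<beta>" and "b \<in> l2_weighted \<beta>" and "c \<in> l2_weighted \<beta>"
  shows "ip \<beta> c (\<lambda>n. s * a n + t * b n) = cnj s * ip \<beta> c a + cnj t * ip \<beta> c b"
proof -
  have "ip \<beta> c (\<lambda>n. s * a n + t * b n) = cnj (ip \<beta> (\<lambda>n. s * a n + t * b n) c)"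
    by (rule ip_cnj[symmetric]) (intro l2_comb assms)+
  also have "\<dots> = cnj s * ip \<beta> c a + cnj t * ip \<beta> c b"
    using assms by (simp add: ip_comb_left ip_cnj)
  finally show ?thesis .
qed

lemma ip_unit_seq_right: "ip \<beta> a (unit_seq k) = a k * of_real ((\<beta> k)\<^sup>2)"
  unfolding ip_def by (subst suminf_finite[of "{k}"]) (auto simp: unit_seq_def)

lemma ip_unit_seq_left: "ip \<beta> (unit_seq k) a = cnj (a k) * of_real ((\<beta> k)\<^sup>2)"
  unfolding ip_def by (subst suminf_finite[of "{k}"]) (auto simp: unit_seq_def)

lemma ip_self_neq_0:
  assumes "a \<in> l2_weighted \<beta>" and "a k \<noteq> 0" and "\<beta> k \<noteq> 0"
  shows "ip \<beta> a a \<noteq> 0" and "ip \<beta> a a = of_real (Re (ip \<beta> a a))" and "Re (ip \<beta> a a) > 0"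
proof -
  have "a n * cnj (a n) * of_real ((\<beta> n)\<^sup>2) = of_real ((cmod (a n))\<^sup>2 * (\<beta> n)\<^sup>2)" for n
    by (simp only: of_real_mult complex_norm_square)
  then have 1: "ip \<beta> a a = of_real (\<Sum>n. (cmod (a n))\<^sup>2 * (\<beta> n)\<^sup>2)"
    unfolding ip_def by (simp only: suminf_of_real[OF l2_summable[OF assms(1)]])
  have "0 < (cmod (a k))\<^sup>2 * (\<beta> k)\<^sup>2"
    using assms by simp
  also have "\<dots> \<le> (\<Sum>n. (cmod (a n))\<^sup>2 * (\<beta> n)\<^sup>2)"
    using sum_le_suminf[OF l2_summable[OF assms(1)], of "{k}"] by simp
  finally show "ip \<beta> a a \<noteq> 0" "ip \<beta> a a = of_real (Re (ip \<beta> a a))" "Re (ip \<beta> a a) > 0"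
    using 1 by auto
qed

section \<open>Twisted conjugations and reflections\<close>

text \<open>For unimodular \<open>w\<close>, these are the conjugations for which every exponential is an eigenvector.\<close>

definition twist :: "(nat \<Rightarrow> complex) \<Rightarrow> (nat \<Rightarrow> complex) \<Rightarrow> nat \<Rightarrow> complex" where
  "twist w a = (\<lambda>n. cnj (a n) * w n)"

definition reflection ::
  "(nat \<Rightarrow> real) \<Rightarrow> (nat \<Rightarrow> complex) \<Rightarrow> (nat \<Rightarrow> complex) \<Rightarrow> nat \<Rightarrow> complex" where
  "reflection \<beta> d a = (\<lambda>n. 1 * a n + (- (2 * ip \<beta> a d / ip \<beta> d d)) * d n)"

lemma twist_l2:
  assumes "\<And>n. cmod (w n) = 1" and "a \<in> l2_weighted \<beta>"
  shows "twist w a \<in> l2_weighted \<beta>"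
  by (rule l2_if_bounded_multiple[OF assms(2), where K = 1]) (simp add: twist_def norm_mult assms(1))

lemma twist_comb:
  "twist w (\<lambda>n. s * a n + t * b n) = (\<lambda>n. cnj s * twist w a n + cnj t * twist w b n)"
  by (simp add: twist_def fun_eq_iff algebra_simps)

lemma unimodular_mult_cnj: "cmod w = 1 \<Longrightarrow> w * cnj w = 1"
  by (simp add: complex_norm_square[symmetric])

lemma twist_twist:
  assumes "\<And>n. cmod (w n) = 1"
  shows "twist w (twist w a) = a"
proof
  fix n
  have "twist w (twist w a) n = a n * (w n * cnj (w n))"
    by (simp add: twist_def)
  then show "twist w (twist w a) n = a n"
    by (simp add: unimodular_mult_cnj assms)
qed

lemma ip_twist:
  assumes "\<And>n. cmod (w n) = 1"
  shows "ip \<beta> (twist w a) (twist w b) = ip \<beta> b a"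
proof -
  have "twist w a n * cnj (twist w b n) = (w n * cnj (w n)) * (b n * cnj (a n))" for n
    by (simp add: twist_def)
  then show ?thesis
    unfolding ip_def by (simp add: unimodular_mult_cnj assms)
qed

lemma reflection_l2:
  "d \<in> l2_weighted \<beta> \<Longrightarrow> a \<in> l2_weighted \<beta> \<Longrightarrow> reflection \<beta> d a \<in> l2_weighted \<beta>"
  unfolding reflection_def by (rule l2_comb)

lemma reflection_comb:
  assumes "d \<in> l2_weighted \<beta>" and "a \<in> l2_weighted \<beta>" and "b \<in> l2_weighted \<beta>"
  shows "reflection \<beta> d (\<lambda>n. s * a n + t * b n)
    = (\<lambda>n. s * reflection \<beta> d a n + t * reflection \<beta> d b n)"
  using assms by (simp add: reflection_def fun_eq_iff ip_comb_left add_divide_distrib algebra_simps)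

lemma ip_reflection_axis:
  assumes "d \<in> l2_weighted \<beta>" and "a \<in> l2_weighted \<beta>" and "ip \<beta> d d \<noteq> 0"
  shows "ip \<beta> (reflection \<beta> d a) d = - ip \<beta> a d"
  unfolding reflection_def using assms by (subst ip_comb_left) auto

lemma reflection_reflection:
  assumes "d \<in> l2_weighted \<beta>" and "a \<in> l2_weighted \<beta>" and "ip \<beta> d d \<noteq> 0"
  shows "reflection \<beta> d (reflection \<beta> d a) = a"
  unfolding reflection_def[of \<beta> d "reflection \<beta> d a"] ip_reflection_axis[OF assms]
  by (simp add: reflection_def)

lemma ip_reflection:
  assumes d: "d \<in> l2_weighted \<beta>" "ip \<beta> d d \<noteq> 0" and a: "a \<in> l2_weighted \<beta>" and b: "b \<in> l2_weighted \<beta>"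
  shows "ip \<beta> (reflection \<beta> d a) (reflection \<beta> d b) = ip \<beta> a b"
proof -
  define s where "s = - (2 * ip \<beta> b d / ip \<beta> d d)"
  have "ip \<beta> (reflection \<beta> d a) (reflection \<beta> d b)
      = ip \<beta> (reflection \<beta> d a) b + cnj s * ip \<beta> (reflection \<beta> d a) d"
    unfolding reflection_def[of \<beta> d b] s_def[symmetric]
    by (subst ip_comb_right) (simp_all add: reflection_l2 a b d)
  also have "\<dots> = ip \<beta> (reflection \<beta> d a) b - cnj s * ip \<beta> a d"
    by (simp add: ip_reflection_axis a d)
  also have "ip \<beta> (reflection \<beta> d a) b = ip \<beta> a b - 2 * ip \<beta> a d / ip \<beta> d d * ip \<beta> d b"
    unfolding reflection_def by (subst ip_comb_left) (simp_all add: a b d)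
  also have "cnj s = - (2 * ip \<beta> d b / ip \<beta> d d)"
    unfolding s_def by (simp add: ip_cnj a b d)
  finally show ?thesis by (simp add: field_simps)
qed

text \<open>An antiunitary map commutes with the reflection in the hyperplane orthogonal to any vector
  it fixes; this is what makes the composite of the two an involution.\<close>

lemma twist_reflection:
  assumes w: "\<And>n. cmod (w n) = 1" and d: "d \<in> l2_weighted \<beta>" "twist w d = d" and a: "a \<in> l2_weighted \<beta>"
  shows "twist w (reflection \<beta> d a) = reflection \<beta> d (twist w a)"
proof -
  have "ip \<beta> (twist w a) d = ip \<beta> d a"
    using ip_twist[of w \<beta> a d] w d by simp
  moreover have "cnj (ip \<beta> a d) = ip \<beta> d a" "cnj (ip \<beta> d d) = ip \<beta> d d"
    using a d by (simp_all add: ip_cnj)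
  ultimately show ?thesis
    unfolding reflection_def twist_comb by (simp add: d)
qed

section \<open>The space of Dirichlet series\<close>

locale dirichlet_space =
  fixes \<Lambda> \<beta> :: "nat \<Rightarrow> real"
  assumes freq_strict_mono: "strict_mono \<Lambda>"
    and freq_nonneg: "0 \<le> \<Lambda> n"
    and freq_at_top: "filterlim \<Lambda> at_top sequentially"
    and freq_growth_finite: "freq_growth \<Lambda> < \<infinity>"
    and weight_pos: "0 < \<beta> n"
    and weight_growth_finite: "weight_growth \<beta> \<Lambda> \<noteq> \<infinity>" "weight_growth \<beta> \<Lambda> \<noteq> - \<infinity>"
begin

abbreviation "l2 \<equiv> l2_weighted \<beta>"

definition ser :: "(nat \<Rightarrow> complex) \<Rightarrow> complex \<Rightarrow> complex" where
  "ser a = restr_H \<beta> \<Lambda> (dirichlet_series \<Lambda> a)"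

text \<open>The coefficients of the reproducing kernel at \<open>w\<close>.\<close>

definition kern :: "complex \<Rightarrow> nat \<Rightarrow> complex" where
  "kern w n = exp (- (of_real (\<Lambda> n) * cnj w)) / of_real ((\<beta> n)\<^sup>2)"

lemma dom_H_cong: "Re z = Re w \<Longrightarrow> z \<in> dom_H \<beta> \<Lambda> \<longleftrightarrow> w \<in> dom_H \<beta> \<Lambda>"
  by (simp add: dom_H_def half_plane_def)

lemma dom_H_of_real: "\<exists>r. \<forall>x>r. complex_of_real x \<in> dom_H \<beta> \<Lambda>"
  by (auto simp: dom_H_def half_plane_def)

text \<open>With \<open>L\<close> and \<open>B\<close> the growth rates of frequencies and weights, eventually
  \<open>1 / (\<beta> n)\<^sup>2 \<le> exp (- 2 (B - \<epsilon>) \<Lambda> n)\<close> and \<open>n + 1 \<le> exp ((L + \<epsilon>) \<Lambda> n)\<close>. Since \<open>2 (Re w + B) > L\<close>,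
  the terms are eventually bounded by \<open>(n + 1) powr (- p)\<close> for some \<open>p > 1\<close>.\<close>

lemma summable_kernel:
  assumes "w \<in> dom_H \<beta> \<Lambda>"
  shows "summable (\<lambda>n. exp (- (2 * \<Lambda> n * Re w)) / (\<beta> n)\<^sup>2)"
proof -
  have nonneg: "0 \<le> freq_growth \<Lambda>"
  proof -
    have "0 \<le> liminf (\<lambda>n. ereal (ln (real (Suc n)) / \<Lambda> n))"
      by (rule Liminf_bounded) (simp add: freq_nonneg)
    also have "\<dots> \<le> freq_growth \<Lambda>"
      unfolding freq_growth_def by (rule Liminf_le_Limsup) simp
    finally show ?thesis .
  qed
  then obtain L where L: "freq_growth \<Lambda> = ereal L" "0 \<le> L"
    using freq_growth_finite by (cases "freq_growth \<Lambda>") auto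
  obtain B where B: "weight_growth \<beta> \<Lambda> = ereal B"
    using weight_growth_finite by (cases "weight_growth \<beta> \<Lambda>") auto
  define \<delta> where "\<delta> = Re w + B - L / 2"
  have \<delta>: "\<delta> > 0"
    using assms by (simp add: dom_H_def half_plane_def L B \<delta>_def)
  define p where "p = (L + 3 * \<delta> / 2) / (L + \<delta> / 2)"
  have p: "p > 1"
    using \<delta> L by (simp add: p_def field_simps)
  have "limsup (\<lambda>n. ereal (ln (real (Suc n)) / \<Lambda> n)) < ereal (L + \<delta> / 2)"
    using L \<delta> by (simp add: freq_growth_def)
  then have ev1: "\<forall>\<^sub>F n in sequentially. ereal (ln (real (Suc n)) / \<Lambda> n) < ereal (L + \<delta> / 2)"
    by (rule Limsup_lessD)
  have "ereal (B - \<delta> / 4) < liminf (\<lambda>n. ereal (ln (\<beta> n) / \<Lambda> n))"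
    using B \<delta> by (simp add: weight_growth_def)
  then have ev2: "\<forall>\<^sub>F n in sequentially. ereal (B - \<delta> / 4) < ereal (ln (\<beta> n) / \<Lambda> n)"
    by (rule less_LiminfD)
  have ev3: "\<forall>\<^sub>F n in sequentially. \<Lambda> n > 0"
    using freq_at_top by (rule filterlim_at_top_dense[THEN iffD1, rule_format])
  from ev1 ev2 ev3
  have "\<forall>\<^sub>F n in sequentially. norm (exp (- (2 * \<Lambda> n * Re w)) / (\<beta> n)\<^sup>2) \<le> real (Suc n) powr (- p)"
  proof eventually_elim
    case (elim n)
    have e1: "ln (real (Suc n)) \<le> (L + \<delta> / 2) * \<Lambda> n"
      using elim by (simp add: pos_divide_less_eq)
    have e2: "(B - \<delta> / 4) * \<Lambda> n \<le> ln (\<beta> n)"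
      using elim by (simp add: pos_less_divide_eq)
    have "p * ln (real (Suc n)) \<le> p * ((L + \<delta> / 2) * \<Lambda> n)"
      using e1 p by (intro mult_left_mono) auto
    also have "\<dots> = (L + 3 * \<delta> / 2) * \<Lambda> n"
      using \<delta> L by (simp add: p_def)
    also have "\<dots> = 2 * \<Lambda> n * Re w + 2 * ((B - \<delta> / 4) * \<Lambda> n)"
      by (simp add: \<delta>_def field_simps)
    also have "\<dots> \<le> 2 * \<Lambda> n * Re w + 2 * ln (\<beta> n)"
      using e2 by simp
    finally have "exp (- (2 * \<Lambda> n * Re w) - 2 * ln (\<beta> n)) \<le> exp (- p * ln (real (Suc n)))"
      by simp
    moreover have "exp (2 * ln (\<beta> n)) = (\<beta> n)\<^sup>2"
      using weight_pos[of n] exp_of_nat_mult[of 2 "ln (\<beta> n)"] by simp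
    ultimately show ?case
      by (simp add: exp_diff powr_def)
  qed
  moreover have "summable (\<lambda>n. real (Suc n) powr (- p))"
    using p by (subst summable_Suc_iff) (simp add: summable_real_powr_iff)
  ultimately show ?thesis
    by (rule summable_comparison_test_ev)
qed

lemma kern_l2:
  assumes "w \<in> dom_H \<beta> \<Lambda>"
  shows "kern w \<in> l2"
proof -
  have "(cmod (kern w n))\<^sup>2 * (\<beta> n)\<^sup>2 = exp (- (2 * \<Lambda> n * Re w)) / (\<beta> n)\<^sup>2" for n
  proof -
    have "cmod (kern w n) = exp (- (\<Lambda> n * Re w)) / (\<beta> n)\<^sup>2"
      by (simp add: kern_def norm_divide norm_power)
    moreover have "(exp (- (\<Lambda> n * Re w)))\<^sup>2 = exp (- (2 * \<Lambda> n * Re w))"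
      by (simp add: power2_eq_square exp_add[symmetric])
    ultimately show ?thesis
      using weight_pos[of n] by (simp add: power_divide power2_eq_square)
  qed
  then show ?thesis
    using summable_kernel[OF assms] by (simp add: l2_weighted_def)
qed

lemma mult_cnj_kern: "a n * cnj (kern w n) * of_real ((\<beta> n)\<^sup>2) = a n * exp (- (of_real (\<Lambda> n) * w))"
  using weight_pos[of n] by (simp add: kern_def exp_cnj)

lemma dirichlet_series_eq_ip: "dirichlet_series \<Lambda> a w = ip \<beta> a (kern w)"
  unfolding dirichlet_series_def ip_def mult_cnj_kern ..

lemma dirichlet_series_abs_summable:
  assumes "a \<in> l2" and "w \<in> dom_H \<beta> \<Lambda>"
  shows "summable (\<lambda>n. cmod (a n * exp (- (of_real (\<Lambda> n) * w))))"
  using ip_abs_summable[OF assms(1) kern_l2[OF assms(2)]] by (simp only: mult_cnj_kern)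

text \<open>If the terms before index \<open>m\<close> vanish, then after multiplication by \<open>exp (\<Lambda> m * x)\<close> all terms
  but the one with index \<open>m\<close> decay uniformly as \<open>x\<close> tends to infinity, the slowest at the rate
  given by the gap between \<open>\<Lambda> m\<close> and \<open>\<Lambda> (Suc m)\<close>.\<close>

lemma dirichlet_series_zero_imp_coeffs_zero:
  assumes abs: "summable (\<lambda>n. cmod (c n * exp (- (of_real (\<Lambda> n) * of_real x0))))"
    and zero: "\<And>x. x \<ge> x0 \<Longrightarrow> dirichlet_series \<Lambda> c (of_real x) = 0"
  shows "c m = 0"
proof (induction m rule: less_induct)
  case (less m)
  define g where "g = (\<lambda>x n. c n * exp (- (of_real (\<Lambda> n) * complex_of_real x)))"
  have norm_g: "cmod (g x n) = cmod (c n) * exp (- (\<Lambda> n * x))" for x n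
    by (simp add: g_def norm_mult)
  have mono: "\<Lambda> i \<le> \<Lambda> j" if "i \<le> j" for i j
    using freq_strict_mono that by (simp add: strict_mono_less_eq)
  have tail0: "summable (\<lambda>n. cmod (g x0 (n + Suc m)))"
    using abs unfolding g_def by (rule summable_ignore_initial_segment)
  define M where "M = (\<Sum>n. cmod (g x0 (n + Suc m)))"
  define \<gamma> where "\<gamma> = \<Lambda> (Suc m) - \<Lambda> m"
  have \<gamma>: "\<gamma> > 0"
    using freq_strict_mono by (simp add: \<gamma>_def strict_mono_def)
  have bound: "cmod (c m) \<le> exp (\<Lambda> m * x0) * M * exp (- (\<gamma> * (x - x0)))" if x: "x \<ge> x0" for x
  proof -
    define e where "e = exp (- (\<Lambda> (Suc m) * (x - x0)))"
    have le: "cmod (g x (n + Suc m)) \<le> e * cmod (g x0 (n + Suc m))" for n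
    proof -
      have "\<Lambda> (Suc m) * (x - x0) \<le> \<Lambda> (n + Suc m) * (x - x0)"
        using x by (intro mult_right_mono mono) auto
      then have "exp (- (\<Lambda> (n + Suc m) * x)) \<le> e * exp (- (\<Lambda> (n + Suc m) * x0))"
        unfolding e_def exp_add[symmetric] by (simp add: algebra_simps)
      then have "cmod (c (n + Suc m)) * exp (- (\<Lambda> (n + Suc m) * x))
          \<le> cmod (c (n + Suc m)) * (e * exp (- (\<Lambda> (n + Suc m) * x0)))"
        by (rule mult_left_mono) simp
      then show ?thesis
        unfolding norm_g by (simp only: mult.left_commute)
    qed
    have sum_e: "summable (\<lambda>n. e * cmod (g x0 (n + Suc m)))"
      using tail0 by (rule summable_mult)
    have tail: "summable (\<lambda>n. cmod (g x (n + Suc m)))"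
      by (rule summable_comparison_test'[OF sum_e, where N = 0]) (use le in simp)
    have "summable (\<lambda>n. g x (n + Suc m))"
      using tail by (rule summable_norm_cancel)
    then have summ: "summable (g x)"
      by (rule summable_iff_shift[THEN iffD1])
    have "0 = (\<Sum>n. g x n)"
      using zero[OF x] by (simp add: dirichlet_series_def g_def)
    also have "\<dots> = (\<Sum>n. g x (n + Suc m)) + (\<Sum>i<Suc m. g x i)"
      using summ by (rule suminf_split_initial_segment)
    also have "(\<Sum>i<Suc m. g x i) = g x m"
      using less.IH by (simp add: g_def)
    finally have "g x m = - (\<Sum>n. g x (n + Suc m))"
      by (simp add: eq_neg_iff_add_eq_0 add.commute)
    then have "cmod (g x m) = cmod (\<Sum>n. g x (n + Suc m))"
      by simp
    also have "\<dots> \<le> (\<Sum>n. cmod (g x (n + Suc m)))"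
      using tail by (rule summable_norm)
    also have "\<dots> \<le> (\<Sum>n. e * cmod (g x0 (n + Suc m)))"
      using le tail sum_e by (rule suminf_le)
    also have "\<dots> = e * M"
      unfolding M_def using tail0 by (rule suminf_mult)
    finally have "cmod (c m) * exp (- (\<Lambda> m * x)) \<le> e * M"
      by (simp add: norm_g)
    then have "cmod (c m) * exp (- (\<Lambda> m * x)) * exp (\<Lambda> m * x) \<le> e * M * exp (\<Lambda> m * x)"
      by (rule mult_right_mono) simp
    moreover have "e * M * exp (\<Lambda> m * x) = exp (\<Lambda> m * x0) * M * exp (- (\<gamma> * (x - x0)))"
    proof -
      have "e * exp (\<Lambda> m * x) = exp (\<Lambda> m * x0) * exp (- (\<gamma> * (x - x0)))"
        unfolding e_def \<gamma>_def exp_add[symmetric] by (simp add: algebra_simps)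
      then show ?thesis by (metis mult.assoc mult.commute)
    qed
    moreover have "cmod (c m) * exp (- (\<Lambda> m * x)) * exp (\<Lambda> m * x) = cmod (c m)"
      by (simp add: mult.assoc exp_add[symmetric])
    ultimately show ?thesis by (simp only:)
  qed
  have "((\<lambda>x. exp (\<Lambda> m * x0) * M * exp (- (\<gamma> * (x - x0)))) \<longlongrightarrow> exp (\<Lambda> m * x0) * M * 0) at_top"
  proof (intro tendsto_mult tendsto_const)
    have "filterlim (\<lambda>x. - x0 + x) at_top at_top"
      by (rule filterlim_tendsto_add_at_top[OF tendsto_const filterlim_ident])
    then have "filterlim (\<lambda>x. \<gamma> * (- x0 + x)) at_top at_top"
      by (rule filterlim_tendsto_pos_mult_at_top[OF tendsto_const \<gamma>])
    then have "filterlim (\<lambda>x. - (\<gamma> * (- x0 + x))) at_bot at_top"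
      by (simp add: filterlim_uminus_at_top)
    then show "((\<lambda>x. exp (- (\<gamma> * (x - x0)))) \<longlongrightarrow> 0) at_top"
      by (simp add: filterlim_compose[OF exp_at_bot])
  qed
  moreover have "\<forall>\<^sub>F x in at_top. cmod (c m) \<le> exp (\<Lambda> m * x0) * M * exp (- (\<gamma> * (x - x0)))"
    using eventually_ge_at_top[of x0] by eventually_elim (rule bound)
  ultimately have "cmod (c m) \<le> exp (\<Lambda> m * x0) * M * 0"
    by (intro tendsto_lowerbound[where F = at_top]) auto
  then show ?case by simp
qed

lemma dirichlet_series_unique:
  assumes a: "summable (\<lambda>n. cmod (a n * exp (- (of_real (\<Lambda> n) * of_real x0))))"
    and b: "summable (\<lambda>n. cmod (b n * exp (- (of_real (\<Lambda> n) * of_real x0))))"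
    and eq: "\<And>x. x \<ge> x0 \<Longrightarrow> dirichlet_series \<Lambda> a (of_real x) = dirichlet_series \<Lambda> b (of_real x)"
  shows "a = b"
proof -
  have summ: "summable (\<lambda>n. cmod (c n * exp (- (of_real (\<Lambda> n) * of_real x))))"
    if c: "summable (\<lambda>n. cmod (c n * exp (- (of_real (\<Lambda> n) * of_real x0))))" and x: "x \<ge> x0" for c x
  proof (rule summable_comparison_test'[OF c, where N = 0])
    fix n
    have "\<Lambda> n * x0 \<le> \<Lambda> n * x"
      using x freq_nonneg by (rule mult_left_mono)
    then show "norm (cmod (c n * exp (- (of_real (\<Lambda> n) * of_real x))))
        \<le> cmod (c n * exp (- (of_real (\<Lambda> n) * of_real x0)))"
      by (simp add: norm_mult mult_left_mono)
  qed
  have "a m - b m = 0" for m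
  proof (rule dirichlet_series_zero_imp_coeffs_zero[where c = "\<lambda>n. a n - b n" and ?x0.0 = x0])
    show "summable (\<lambda>n. cmod ((a n - b n) * exp (- (of_real (\<Lambda> n) * of_real x0))))"
      by (rule summable_comparison_test'[OF summable_add[OF a b], where N = 0])
        (simp add: left_diff_distrib norm_triangle_ineq4)
    fix x assume x: "x \<ge> x0"
    show "dirichlet_series \<Lambda> (\<lambda>n. a n - b n) (of_real x) = 0"
      using suminf_diff[OF summable_norm_cancel[OF summ[OF a x]] summable_norm_cancel[OF summ[OF b x]]]
        eq[OF x]
      by (simp add: dirichlet_series_def left_diff_distrib)
  qed
  then show ?thesis by auto
qed

lemma ser_inject:
  assumes "a \<in> l2" and "b \<in> l2" and "ser a = ser b"
  shows "a = b"
proof -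
  obtain r where r: "\<And>x. x > r \<Longrightarrow> complex_of_real x \<in> dom_H \<beta> \<Lambda>"
    using dom_H_of_real by blast
  show ?thesis
  proof (rule dirichlet_series_unique[where ?x0.0 = "r + 1"])
    fix x assume "x \<ge> r + 1"
    then have "complex_of_real x \<in> dom_H \<beta> \<Lambda>" using r by simp
    then show "dirichlet_series \<Lambda> a (of_real x) = dirichlet_series \<Lambda> b (of_real x)"
      using fun_cong[OF assms(3), of "of_real x"] by (simp add: ser_def restr_H_def)
  qed (intro dirichlet_series_abs_summable assms r; simp)+
qed

lemma is_coeffs_iff: "is_coeffs \<beta> \<Lambda> f a \<longleftrightarrow> a \<in> l2 \<and> f = ser a"
  by (simp add: is_coeffs_def l2_weighted_def ser_def)

lemma space_H_eq: "space_H \<beta> \<Lambda> = ser ` l2"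
  by (auto simp: space_H_def is_coeffs_iff)

lemma coeffs_ser: "a \<in> l2 \<Longrightarrow> coeffs_H \<beta> \<Lambda> (ser a) = a"
  unfolding coeffs_H_def is_coeffs_iff using ser_inject by blast

lemma inner_ser: "a \<in> l2 \<Longrightarrow> b \<in> l2 \<Longrightarrow> inner_H \<beta> \<Lambda> (ser a) (ser b) = ip \<beta> a b"
  by (simp add: inner_H_def ip_def coeffs_ser)

lemma norm_ser: "a \<in> l2 \<Longrightarrow> norm_H \<beta> \<Lambda> (ser a) = sqrt (Re (ip \<beta> a a))"
  by (simp add: norm_H_def inner_ser)

lemma ser_at: "z \<in> dom_H \<beta> \<Lambda> \<Longrightarrow> ser a z = ip \<beta> a (kern z)"
  by (simp add: ser_def restr_H_def dirichlet_series_eq_ip)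

lemma ser_outside: "z \<notin> dom_H \<beta> \<Lambda> \<Longrightarrow> ser a z = 0"
  by (simp add: ser_def restr_H_def)

lemma ser_comb:
  assumes "a \<in> l2" and "b \<in> l2"
  shows "(\<lambda>z. s * ser a z + t * ser b z) = ser (\<lambda>n. s * a n + t * b n)"
proof
  fix z
  show "s * ser a z + t * ser b z = ser (\<lambda>n. s * a n + t * b n) z"
    using assms kern_l2
    by (cases "z \<in> dom_H \<beta> \<Lambda>") (simp_all add: ser_at ser_outside ip_comb_left)
qed

lemma conjugation_if_on_coeffs:
  assumes act: "\<And>a. a \<in> l2 \<Longrightarrow> C (ser a) = ser (S a)"
    and mem: "\<And>a. a \<in> l2 \<Longrightarrow> S a \<in> l2"
    and anti: "\<And>a b s t. a \<in> l2 \<Longrightarrow> b \<in> l2 \<Longrightarrow>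
      S (\<lambda>n. s * a n + t * b n) = (\<lambda>n. cnj s * S a n + cnj t * S b n)"
    and isom: "\<And>a. a \<in> l2 \<Longrightarrow> ip \<beta> (S a) (S a) = ip \<beta> a a"
    and inv: "\<And>a. a \<in> l2 \<Longrightarrow> S (S a) = a"
  shows "conjugation \<beta> \<Lambda> C"
  unfolding conjugation_def space_H_eq
proof (intro conjI ballI allI)
  show "C ` ser ` l2 \<subseteq> ser ` l2"
    using act mem by auto
next
  fix f g s t assume "f \<in> ser ` l2" "g \<in> ser ` l2"
  then obtain a b where "a \<in> l2" "b \<in> l2" "f = ser a" "g = ser b" by auto
  then show "C (\<lambda>z. s * f z + t * g z) = (\<lambda>z. cnj s * C f z + cnj t * C g z)"
    by (simp add: ser_comb act l2_comb anti mem)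
next
  fix f assume "f \<in> ser ` l2"
  then show "norm_H \<beta> \<Lambda> (C f) = norm_H \<beta> \<Lambda> f"
    by (auto simp: act mem norm_ser isom)
next
  fix f assume "f \<in> ser ` l2"
  then show "C (C f) = f"
    by (auto simp: act mem inv)
qed

text \<open>The candidate is the only one because the pairing with the unit sequences determines it.\<close>

lemma adjoint_eqI:
  assumes "\<And>a. a \<in> l2 \<Longrightarrow> T (ser a) = ser (S a)" and "\<And>a. a \<in> l2 \<Longrightarrow> S a \<in> l2"
    and "g \<in> l2" and "h \<in> l2" and "\<And>a. a \<in> l2 \<Longrightarrow> ip \<beta> (S a) g = ip \<beta> a h"
  shows "adjoint_H \<beta> \<Lambda> T (ser g) = ser h"
  unfolding adjoint_H_def space_H_eq
proof (rule the_equality)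
  show "ser h \<in> ser ` l2 \<and> (\<forall>f\<in>ser ` l2. inner_H \<beta> \<Lambda> (T f) (ser g) = inner_H \<beta> \<Lambda> f (ser h))"
    using assms by (auto simp: inner_ser)
  fix k assume k: "k \<in> ser ` l2 \<and> (\<forall>f\<in>ser ` l2. inner_H \<beta> \<Lambda> (T f) (ser g) = inner_H \<beta> \<Lambda> f k)"
  then obtain h' where h': "h' \<in> l2" "k = ser h'" by auto
  have ip_eq: "ip \<beta> a h' = ip \<beta> a h" if "a \<in> l2" for a
    using k h' assms that by (auto simp: inner_ser)
  have "h' n = h n" for n
    using ip_eq[OF l2_unit_seq, of n] weight_pos[of n] by (simp add: ip_unit_seq_left)
  then have "h' = h" by auto
  then show "k = ser h" using h' by simp
qed

section \<open>Translations\<close>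

lemma comp_translation_ser:
  assumes "\<And>z. z \<in> dom_H \<beta> \<Lambda> \<Longrightarrow> \<phi> z = z + b"
    and "\<And>z. z \<in> dom_H \<beta> \<Lambda> \<Longrightarrow> \<phi> z \<in> dom_H \<beta> \<Lambda>"
  shows "comp_op \<beta> \<Lambda> \<phi> (ser a) = ser (\<lambda>n. a n * exp (- (of_real (\<Lambda> n) * b)))"
proof
  fix z
  show "comp_op \<beta> \<Lambda> \<phi> (ser a) z = ser (\<lambda>n. a n * exp (- (of_real (\<Lambda> n) * b))) z"
    using assms[of z]
    by (auto simp: comp_op_def ser_def restr_H_def dirichlet_series_def exp_add[symmetric] algebra_simps)
qed

lemma J_translation_ser:
  assumes "a \<in> l2"
  shows "J_op \<beta> \<Lambda> (\<lambda>z. z + of_real c * \<i>) (ser a)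
    = ser (twist (\<lambda>n. exp (- (of_real (\<Lambda> n) * (of_real c * \<i>)))) a)" (is "_ = ser ?b")
proof
  fix z
  show "J_op \<beta> \<Lambda> (\<lambda>z. z + of_real c * \<i>) (ser a) z = ser ?b z"
  proof (cases "z \<in> dom_H \<beta> \<Lambda>")
    case True
    define w where "w = cnj (z + of_real c * \<i>)"
    have w: "w \<in> dom_H \<beta> \<Lambda>"
      using True by (subst dom_H_cong[of w z]) (simp_all add: w_def)
    have "summable (\<lambda>n. a n * exp (- (of_real (\<Lambda> n) * w)))"
      using dirichlet_series_abs_summable[OF assms w] by (rule summable_norm_cancel)
    then have "(\<lambda>n. a n * exp (- (of_real (\<Lambda> n) * w))) sums ser a w"
      using w by (simp add: ser_def restr_H_def dirichlet_series_def summable_sums)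
    then have "(\<lambda>n. cnj (a n * exp (- (of_real (\<Lambda> n) * w)))) sums cnj (ser a w)"
      by (simp only: sums_cnj)
    moreover have "cnj (a n * exp (- (of_real (\<Lambda> n) * w))) = ?b n * exp (- (of_real (\<Lambda> n) * z))" for n
    proof -
      have "- (of_real (\<Lambda> n) * cnj w) = - (of_real (\<Lambda> n) * (of_real c * \<i>)) + - (of_real (\<Lambda> n) * z)"
        by (simp add: w_def algebra_simps)
      then show ?thesis
        by (simp add: twist_def exp_cnj exp_add[symmetric])
    qed
    ultimately show ?thesis
      using True by (simp add: J_op_def ser_def[of ?b] restr_H_def dirichlet_series_def sums_iff w_def)
  qed (simp add: J_op_def restr_H_def ser_outside)
qed

lemma J_translation_conjugation:
  "composition_conjugation \<beta> \<Lambda> (\<lambda>z. z + of_real c * \<i>)"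
proof -
  have "holo_self_map \<beta> \<Lambda> (\<lambda>z. z + of_real c * \<i>)"
    unfolding holo_self_map_def
    by (auto intro!: holomorphic_intros simp: dom_H_def half_plane_def)
  moreover have "conjugation \<beta> \<Lambda> (J_op \<beta> \<Lambda> (\<lambda>z. z + of_real c * \<i>))"
    by (rule conjugation_if_on_coeffs[
          where S = "twist (\<lambda>n. exp (- (of_real (\<Lambda> n) * (of_real c * \<i>))))", OF J_translation_ser])
      (simp_all add: twist_l2 twist_comb twist_twist ip_twist)
  ultimately show ?thesis by (simp add: composition_conjugation_def)
qed

text \<open>In the orthogonal basis of exponentials, a translation acts as a diagonal matrix and the
  conjugation as entrywise conjugation up to unimodular factors, so that conjugating the former by
  the latter conjugates the diagonal entries.\<close>

lemma translation_symmetric: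
  assumes \<phi>: "\<And>z. z \<in> dom_H \<beta> \<Lambda> \<Longrightarrow> \<phi> z = z + b"
    and self: "\<And>z. z \<in> dom_H \<beta> \<Lambda> \<Longrightarrow> \<phi> z \<in> dom_H \<beta> \<Lambda>"
  shows "symmetric_wrt \<beta> \<Lambda> (J_op \<beta> \<Lambda> (\<lambda>z. z + of_real c * \<i>)) (comp_op \<beta> \<Lambda> \<phi>)"
proof -
  define D where "D = (\<lambda>n. exp (- (of_real (\<Lambda> n) * b)))"
  define w where "w = (\<lambda>n. exp (- (of_real (\<Lambda> n) * (complex_of_real c * \<i>))))"
  have w: "cmod (w n) = 1" for n by (simp add: w_def)
  have Re_b: "0 \<le> Re b"
  proof (rule ccontr)
    assume neg: "\<not> 0 \<le> Re b"
    \<comment> \<open>A point whose distance to the boundary line is \<open>- Re b\<close> would be moved onto that line.\<close>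
    define r where "r = real_of_ereal (freq_growth \<Lambda>) / 2 - real_of_ereal (weight_growth \<beta> \<Lambda>)"
    have dom: "z \<in> dom_H \<beta> \<Lambda> \<longleftrightarrow> r < Re z" for z
      by (simp add: dom_H_def half_plane_def r_def)
    show False
      using \<phi>[of "of_real (r - Re b)"] self[of "of_real (r - Re b)"] neg by (simp add: dom)
  qed
  have T: "comp_op \<beta> \<Lambda> \<phi> (ser a) = ser (\<lambda>n. a n * D n)" for a
    unfolding D_def using \<phi> self by (rule comp_translation_ser)
  have J: "J_op \<beta> \<Lambda> (\<lambda>z. z + of_real c * \<i>) (ser a) = ser (twist w a)" if "a \<in> l2" for a
    unfolding w_def using that by (rule J_translation_ser)
  have D_le: "cmod (D n) \<le> 1" for n
    using Re_b freq_nonneg[of n] by (simp add: D_def)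
  have l2_D: "(\<lambda>n. a n * D n) \<in> l2" "(\<lambda>n. a n * cnj (D n)) \<in> l2" if "a \<in> l2" for a
    using D_le
    by (auto intro!: l2_if_bounded_multiple[OF that, where K = 1] mult_left_le simp: norm_mult)
  have "J_op \<beta> \<Lambda> (\<lambda>z. z + of_real c * \<i>)
      (comp_op \<beta> \<Lambda> \<phi> (J_op \<beta> \<Lambda> (\<lambda>z. z + of_real c * \<i>) (ser a)))
    = adjoint_H \<beta> \<Lambda> (comp_op \<beta> \<Lambda> \<phi>) (ser a)" if a: "a \<in> l2" for a
  proof -
    have "twist w (\<lambda>n. twist w a n * D n) = (\<lambda>n. a n * cnj (D n))"
    proof
      fix n
      have "twist w (\<lambda>n. twist w a n * D n) n = twist w (twist w a) n * cnj (D n)"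
        by (simp add: twist_def)
      then show "twist w (\<lambda>n. twist w a n * D n) n = a n * cnj (D n)"
        by (simp add: twist_twist w)
    qed
    then have "J_op \<beta> \<Lambda> (\<lambda>z. z + of_real c * \<i>)
        (comp_op \<beta> \<Lambda> \<phi> (J_op \<beta> \<Lambda> (\<lambda>z. z + of_real c * \<i>) (ser a))) = ser (\<lambda>n. a n * cnj (D n))"
      by (simp add: J T a l2_D twist_l2 w)
    also have "\<dots> = adjoint_H \<beta> \<Lambda> (comp_op \<beta> \<Lambda> \<phi>) (ser a)"
      by (rule adjoint_eqI[where S = "\<lambda>a n. a n * D n", OF T, symmetric])
        (auto simp: l2_D a ip_def mult_ac)
    finally show ?thesis .
  qed
  then show ?thesis
    by (auto simp: symmetric_wrt_def space_H_eq)
qed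

section \<open>Dilations\<close>

text \<open>A dilation maps the exponential with frequency \<open>\<Lambda> n\<close> to a multiple of the one with frequency
  \<open>\<Lambda> (m n)\<close>. Substitution therefore turns the series of \<open>a\<close> into a Dirichlet series that is
  absolutely convergent on the half-plane; so by uniqueness its coefficients are those of the image.\<close>

lemma comp_dilation_coeffs:
  assumes \<phi>: "\<And>z. z \<in> dom_H \<beta> \<Lambda> \<Longrightarrow> \<phi> z = of_real r * z + b"
    and self: "\<And>z. z \<in> dom_H \<beta> \<Lambda> \<Longrightarrow> \<phi> z \<in> dom_H \<beta> \<Lambda>"
    and m: "\<And>n. r * \<Lambda> n = \<Lambda> (m n)" and r: "r > 0"
    and a: "a \<in> l2" and y: "y \<in> l2" and eq: "comp_op \<beta> \<Lambda> \<phi> (ser a) = ser y"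
  shows "y (m n) = a n * exp (- (of_real (\<Lambda> n) * b))"
    and "k \<notin> range m \<Longrightarrow> y k = 0"
proof -
  have mono: "strict_mono m"
  proof (rule strict_monoI)
    fix i j :: nat assume "i < j"
    then have "r * \<Lambda> i < r * \<Lambda> j"
      using freq_strict_mono r by (simp add: strict_mono_def)
    then show "m i < m j"
      using freq_strict_mono by (simp add: m strict_mono_less)
  qed
  then have inj: "inj m" by (rule strict_mono_imp_inj_on)
  define c where
    "c k = (if k \<in> range m then a (inv m k) * exp (- (of_real (\<Lambda> (inv m k)) * b)) else 0)" for k
  have c_m: "c (m n) = a n * exp (- (of_real (\<Lambda> n) * b))" for n
    by (simp add: c_def inj)
  have c_0: "k \<notin> range m \<Longrightarrow> c k = 0" for k
    by (simp add: c_def)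
  have summand: "c (m n) * exp (- (of_real (\<Lambda> (m n)) * z)) = a n * exp (- (of_real (\<Lambda> n) * \<phi> z))"
    if "z \<in> dom_H \<beta> \<Lambda>" for n z
    unfolding \<phi>[OF that] c_m by (simp add: m[symmetric] exp_add[symmetric] algebra_simps)
  obtain s where s: "\<And>x. x > s \<Longrightarrow> complex_of_real x \<in> dom_H \<beta> \<Lambda>"
    using dom_H_of_real by blast
  have "y = c"
  proof (rule dirichlet_series_unique[where ?x0.0 = "s + 1"])
    have x0: "complex_of_real (s + 1) \<in> dom_H \<beta> \<Lambda>"
      by (rule s) simp
    show "summable (\<lambda>n. cmod (y n * exp (- (of_real (\<Lambda> n) * of_real (s + 1)))))"
      using y x0 by (rule dirichlet_series_abs_summable)
    have "summable (\<lambda>n. cmod (c (m n) * exp (- (of_real (\<Lambda> (m n)) * of_real (s + 1)))))"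
      unfolding summand[OF x0] using a self[OF x0] by (rule dirichlet_series_abs_summable)
    then show "summable (\<lambda>n. cmod (c n * exp (- (of_real (\<Lambda> n) * of_real (s + 1)))))"
      by (subst (asm) summable_mono_reindex[OF mono, of "\<lambda>n. cmod (c n * exp (- (of_real (\<Lambda> n) * of_real (s + 1))))"])
        (auto simp: c_0)
    fix x assume "x \<ge> s + 1"
    then have x: "complex_of_real x \<in> dom_H \<beta> \<Lambda>"
      by (intro s) simp
    have "dirichlet_series \<Lambda> y (of_real x) = dirichlet_series \<Lambda> a (\<phi> (of_real x))"
      using fun_cong[OF eq, of "of_real x"] x self[OF x]
      by (simp add: comp_op_def ser_def restr_H_def)
    also have "\<dots> = (\<Sum>n. c (m n) * exp (- (of_real (\<Lambda> (m n)) * of_real x)))"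
      unfolding dirichlet_series_def summand[OF x] ..
    also have "\<dots> = dirichlet_series \<Lambda> c (of_real x)"
      unfolding dirichlet_series_def
      by (rule suminf_mono_reindex[OF mono, of "\<lambda>n. c n * exp (- (of_real (\<Lambda> n) * of_real x))"])
        (simp add: c_0)
    finally show "dirichlet_series \<Lambda> y (of_real x) = dirichlet_series \<Lambda> c (of_real x)" .
  qed
  then show "y (m n) = a n * exp (- (of_real (\<Lambda> n) * b))" "k \<notin> range m \<Longrightarrow> y k = 0"
    using c_m c_0 by auto
qed

text \<open>Symmetry would give \<open>T (C g) = C (T* g) = C 0 = 0\<close>, hence \<open>C g = 0\<close> and \<open>g = C (C g) = 0\<close>.\<close>

lemma not_symmetric_if_injective_and_adjoint_not:
  assumes C: "conjugation \<beta> \<Lambda> C" and mem: "\<And>f. f \<in> space_H \<beta> \<Lambda> \<Longrightarrow> T f \<in> space_H \<beta> \<Lambda>"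
    and inj: "\<And>f. f \<in> space_H \<beta> \<Lambda> \<Longrightarrow> T f = (\<lambda>_. 0) \<Longrightarrow> f = (\<lambda>_. 0)"
    and g: "g \<in> space_H \<beta> \<Lambda>" "g \<noteq> (\<lambda>_. 0)" "adjoint_H \<beta> \<Lambda> T g = (\<lambda>_. 0)"
  shows "\<not> symmetric_wrt \<beta> \<Lambda> C T"
proof
  assume "symmetric_wrt \<beta> \<Lambda> C T"
  then have 1: "C (T (C g)) = (\<lambda>_. 0)"
    using g by (simp add: symmetric_wrt_def)
  have C_mem: "C f \<in> space_H \<beta> \<Lambda>" and C_C: "C (C f) = f" if "f \<in> space_H \<beta> \<Lambda>" for f
    using C that unfolding conjugation_def by blast+
  have "\<forall>f\<in>space_H \<beta> \<Lambda>. \<forall>g\<in>space_H \<beta> \<Lambda>. \<forall>s t.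
      C (\<lambda>z. s * f z + t * g z) = (\<lambda>z. cnj s * C f z + cnj t * C g z)"
    using C unfolding conjugation_def by blast
  from this[rule_format, OF g(1) g(1), of 0 0] have C_0: "C (\<lambda>_. 0) = (\<lambda>_. 0)" by simp
  have "T (C g) = C (C (T (C g)))"
    using g by (simp add: C_C C_mem mem)
  then have "T (C g) = (\<lambda>_. 0)"
    by (simp add: 1 C_0)
  then have "C g = (\<lambda>_. 0)"
    by (rule inj[OF C_mem[OF g(1)]])
  then show False
    using C_C[of g] g C_0 by simp
qed

lemma ser_zero: "ser (\<lambda>_. 0) = (\<lambda>_. 0)"
  by (simp add: ser_def restr_H_def dirichlet_series_def fun_eq_iff)

text \<open>At least one of \<open>\<Lambda> 0\<close> and \<open>\<Lambda> 1\<close> is not of the form \<open>r * \<Lambda> n\<close>: since \<open>r > 1\<close>, multiplication by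
  \<open>r\<close> raises the index of every positive frequency, so \<open>\<Lambda> 0\<close> is missed if it is positive, and \<open>\<Lambda> 1\<close>
  is missed if \<open>\<Lambda> 0 = 0\<close>. The corresponding exponential is orthogonal to the range, although the
  operator is injective.\<close>

lemma dilation_not_complex_symmetric:
  assumes bdd: "bounded_comp_op \<beta> \<Lambda> \<phi>"
    and \<phi>: "\<And>z. z \<in> dom_H \<beta> \<Lambda> \<Longrightarrow> \<phi> z = of_real r * z + b"
    and r: "r \<in> freq_ratios1 \<Lambda>"
  shows "\<not> complex_symmetric \<beta> \<Lambda> (comp_op \<beta> \<Lambda> \<phi>)"
proof -
  have self: "\<And>z. z \<in> dom_H \<beta> \<Lambda> \<Longrightarrow> \<phi> z \<in> dom_H \<beta> \<Lambda>"
    and mem: "\<And>f. f \<in> space_H \<beta> \<Lambda> \<Longrightarrow> comp_op \<beta> \<Lambda> \<phi> f \<in> space_H \<beta> \<Lambda>"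
    using bdd by (auto simp: bounded_comp_op_def holo_self_map_def)
  have r1: "r > 1"
    using r by (auto simp: freq_ratios1_def freq_ratios_def)
  obtain m where m: "\<And>n. r * \<Lambda> n = \<Lambda> (m n)"
  proof -
    have "\<forall>n. \<exists>m. r * \<Lambda> n = \<Lambda> m"
      using r by (auto simp: freq_ratios1_def freq_ratios_def)
    then show ?thesis
      using that by metis
  qed
  have "\<exists>k. k \<notin> range m"
  proof -
    have less: "n < m n" if "\<Lambda> n > 0" for n
    proof -
      have "\<Lambda> n < \<Lambda> (m n)"
        using that r1 by (simp flip: m)
      then show ?thesis
        using freq_strict_mono by (simp add: strict_mono_less)
    qed
    have pos: "\<Lambda> n > 0" if "n > 0" for n
      using strict_monoD[OF freq_strict_mono that] freq_nonneg[of 0] by simp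
    show ?thesis
    proof (cases "\<Lambda> 0 = 0")
      case True
      then have "\<Lambda> (m 0) = \<Lambda> 0" by (simp flip: m)
      then have "m 0 = 0"
        using freq_strict_mono by (simp add: strict_mono_eq)
      then have "m n \<noteq> 1" for n
        using less[OF pos[of n]] by (cases "n = 0") auto
      then have "1 \<notin> range m" by (metis rangeE)
      then show ?thesis by blast
    next
      case False
      then have "\<Lambda> n > 0" for n
        using pos[of n] freq_nonneg[of 0] by (cases "n = 0") auto
      then have "m n \<noteq> 0" for n
        using less[of n] by auto
      then have "0 \<notin> range m" by (metis rangeE)
      then show ?thesis by blast
    qed
  qed
  then obtain k where k: "k \<notin> range m" by blast
  define S where "S a = coeffs_H \<beta> \<Lambda> (comp_op \<beta> \<Lambda> \<phi> (ser a))" for a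
  have S: "S a \<in> l2" "comp_op \<beta> \<Lambda> \<phi> (ser a) = ser (S a)" if "a \<in> l2" for a
  proof -
    have "comp_op \<beta> \<Lambda> \<phi> (ser a) \<in> ser ` l2"
      using mem[of "ser a"] that by (simp add: space_H_eq)
    then show "S a \<in> l2" "comp_op \<beta> \<Lambda> \<phi> (ser a) = ser (S a)"
      by (auto simp: S_def coeffs_ser)
  qed
  have coeffs: "S a (m n) = a n * exp (- (of_real (\<Lambda> n) * b))" "S a k = 0" if "a \<in> l2" for a n
    using comp_dilation_coeffs[OF \<phi> self m _ that S(1)[OF that] S(2)[OF that]] k r1 by auto
  show ?thesis
    unfolding complex_symmetric_def
  proof (clarify)
    fix C assume C: "conjugation \<beta> \<Lambda> C" "symmetric_wrt \<beta> \<Lambda> C (comp_op \<beta> \<Lambda> \<phi>)"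
    have "\<not> symmetric_wrt \<beta> \<Lambda> C (comp_op \<beta> \<Lambda> \<phi>)"
    proof (rule not_symmetric_if_injective_and_adjoint_not[OF C(1)])
      show "comp_op \<beta> \<Lambda> \<phi> f \<in> space_H \<beta> \<Lambda>" if "f \<in> space_H \<beta> \<Lambda>" for f
        using that by (rule mem)
      show "f = (\<lambda>_. 0)" if f: "f \<in> space_H \<beta> \<Lambda>" "comp_op \<beta> \<Lambda> \<phi> f = (\<lambda>_. 0)" for f
      proof -
        obtain a where a: "a \<in> l2" "f = ser a"
          using f by (auto simp: space_H_eq)
        have "ser (S a) = ser (\<lambda>_. 0)"
          using f a S(2)[OF a(1)] by (simp add: ser_zero)
        then have "S a = (\<lambda>_. 0)"
          using S(1)[OF a(1)] l2_zero by (intro ser_inject)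
        then have "a n = 0" for n
          using coeffs(1)[OF a(1), of n] by simp
        then have "a = (\<lambda>_. 0)" by auto
        then show ?thesis using a by (simp add: ser_zero)
      qed
      show "ser (unit_seq k) \<in> space_H \<beta> \<Lambda>"
        by (simp add: space_H_eq l2_unit_seq)
      show "ser (unit_seq k) \<noteq> (\<lambda>_. 0)"
      proof
        assume "ser (unit_seq k) = (\<lambda>_. 0)"
        then have "unit_seq k = (\<lambda>_. 0)"
          using l2_unit_seq l2_zero by (intro ser_inject) (simp_all add: ser_zero)
        then show False
          by (auto simp: unit_seq_def dest: fun_cong[of _ _ k])
      qed
      have "adjoint_H \<beta> \<Lambda> (comp_op \<beta> \<Lambda> \<phi>) (ser (unit_seq k)) = ser (\<lambda>_. 0)"
      proof (rule adjoint_eqI[where S = S, OF S(2) S(1) l2_unit_seq l2_zero])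
        show "ip \<beta> (S a) (unit_seq k) = ip \<beta> a (\<lambda>_. 0)" if "a \<in> l2" for a
          using coeffs(2)[OF that] by (simp add: ip_unit_seq_right) (simp add: ip_def)
      qed
      then show "adjoint_H \<beta> \<Lambda> (comp_op \<beta> \<Lambda> \<phi>) (ser (unit_seq k)) = (\<lambda>_. 0)"
        by (simp add: ser_zero)
    qed
    then show False using C by simp
  qed
qed

section \<open>Constant symbols\<close>

text \<open>The operator is \<open>f \<mapsto> \<langle>f, v\<rangle> u\<close> with \<open>u\<close> the constant function \<open>1\<close> and \<open>v\<close> the reproducing kernel
  at \<open>b\<close>. The twist by \<open>w\<close> fixes both \<open>u\<close> and \<open>v\<close>, so it commutes with the reflection along
  \<open>d = s u - v\<close>. The composite \<open>R\<close> is a conjugation with \<open>v = s R u\<close>, hence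
  \<open>cnj \<langle>R f, v\<rangle> = s \<langle>f, u\<rangle>\<close>, and conjugating the operator by \<open>R\<close> gives its adjoint
  \<open>f \<mapsto> \<langle>f, u\<rangle> v\<close>.\<close>

lemma constant_complex_symmetric:
  assumes \<Lambda>0: "\<Lambda> 0 = 0" and \<phi>: "\<And>z. z \<in> dom_H \<beta> \<Lambda> \<Longrightarrow> \<phi> z = b" and b: "b \<in> dom_H \<beta> \<Lambda>"
  shows "complex_symmetric \<beta> \<Lambda> (comp_op \<beta> \<Lambda> \<phi>)"
proof -
  define u where "u = unit_seq 0"
  define v where "v = kern b"
  define w where "w = (\<lambda>n. exp (of_real (\<Lambda> n) * (b - cnj b)))"
  have l2: "u \<in> l2" "v \<in> l2"
    using b by (simp_all add: u_def v_def l2_unit_seq kern_l2)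
  have \<beta>: "\<beta> n \<noteq> 0" for n using weight_pos[of n] by simp
  have w: "cmod (w n) = 1" for n by (simp add: w_def)
  have twist_u: "twist w u = u"
    by (auto simp: twist_def u_def unit_seq_def w_def \<Lambda>0)
  have twist_v: "twist w v = v"
    by (auto simp: twist_def v_def kern_def w_def exp_cnj exp_add[symmetric] algebra_simps)
  have v0: "v 0 = 1 / of_real ((\<beta> 0)\<^sup>2)"
    by (simp add: v_def kern_def \<Lambda>0)
  define N where "N = Re (ip \<beta> v v)"
  have "v 0 \<noteq> 0" by (simp add: v0 \<beta>)
  then have N: "ip \<beta> v v = of_real N" "N > 0"
    unfolding N_def using ip_self_neq_0[OF l2(2)] \<beta> by blast+
  \<comment> \<open>The factor \<open>s\<close> gives \<open>s * u\<close> the same norm as \<open>v\<close>, so that a reflection can exchange the two.\<close>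
  define s where "s = sqrt N / \<beta> 0"
  have s: "s > 0" "s\<^sup>2 * (\<beta> 0)\<^sup>2 = N"
    using N weight_pos[of 0] by (simp_all add: s_def power_divide)
  define d where "d = (\<lambda>n. of_real s * u n + (- 1) * v n)"
  have d: "d \<in> l2" unfolding d_def using l2 by (intro l2_comb)
  have twist_d: "twist w d = d"
    unfolding d_def twist_comb twist_u twist_v by simp
  \<comment> \<open>At index \<open>1\<close> the sequence \<open>u\<close> vanishes while the kernel \<open>v\<close>, like all its entries, does not.\<close>
  have d_neq_0: "ip \<beta> d d \<noteq> 0"
  proof (rule ip_self_neq_0(1)[OF d, of 1])
    show "d 1 \<noteq> 0" by (simp add: d_def u_def unit_seq_def v_def kern_def \<beta>)
  qed (rule \<beta>)
  have ip_uu: "ip \<beta> u u = of_real ((\<beta> 0)\<^sup>2)" and ip_uv: "ip \<beta> u v = 1" and ip_vu: "ip \<beta> v u = 1"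
    unfolding u_def ip_unit_seq_left ip_unit_seq_right by (simp_all add: unit_seq_def v0 \<beta>)
  have ip_ud: "ip \<beta> u d = of_real (s * (\<beta> 0)\<^sup>2 - 1)"
    unfolding d_def by (subst ip_comb_right[OF l2 l2(1)]) (simp add: ip_uu ip_uv)
  have ip_vd: "ip \<beta> v d = of_real (s - N)"
    unfolding d_def by (subst ip_comb_right[OF l2 l2(2)]) (simp add: N ip_vu)
  have ip_dd: "ip \<beta> d d = of_real (2 * s) * ip \<beta> u d"
  proof -
    have "ip \<beta> d d = of_real s * ip \<beta> u d - ip \<beta> v d"
      by (subst (1) d_def, subst ip_comb_left[OF l2 d]) simp
    also have "\<dots> = of_real (s * (s * (\<beta> 0)\<^sup>2 - 1) - (s - N))"
      by (simp add: ip_ud ip_vd)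
    also have "s * (s * (\<beta> 0)\<^sup>2 - 1) - (s - N) = 2 * s * (s * (\<beta> 0)\<^sup>2 - 1)"
      unfolding s(2)[symmetric] by (simp add: power2_eq_square algebra_simps)
    finally show ?thesis by (simp add: ip_ud)
  qed
  define R where "R = (\<lambda>a. reflection \<beta> d (twist w a))"
  have R_l2: "R a \<in> l2" if "a \<in> l2" for a
    unfolding R_def using that w d by (intro reflection_l2 twist_l2)
  have ip_R: "ip \<beta> (R a) (R c) = ip \<beta> c a" if "a \<in> l2" "c \<in> l2" for a c
    unfolding R_def using that w d d_neq_0 by (simp add: ip_reflection twist_l2 ip_twist)
  have R_R: "R (R a) = a" if "a \<in> l2" for a
    unfolding R_def using that w d d_neq_0 twist_d
    by (simp add: twist_reflection twist_l2 twist_twist reflection_reflection)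
  have R_comb: "R (\<lambda>n. t * a n + t' * c n) = (\<lambda>n. cnj t * R a n + cnj t' * R c n)"
    if "a \<in> l2" "c \<in> l2" for a c t t'
    unfolding R_def twist_comb using that w d by (simp add: reflection_comb twist_l2)
  have v_eq: "v n = of_real s * R u n" for n
  proof -
    have "2 * ip \<beta> u d / ip \<beta> d d = 1 / of_real s"
      using d_neq_0 s by (simp add: ip_dd)
    then have "R u n = u n - d n / of_real s"
      unfolding R_def twist_u reflection_def by simp
    then show ?thesis using s by (simp add: d_def field_simps)
  qed
  have ip_Rv: "cnj (ip \<beta> (R a) v) = of_real s * ip \<beta> a u" if a: "a \<in> l2" for a
  proof -
    have "ip \<beta> (R a) v = ip \<beta> (R a) (\<lambda>n. of_real s * R u n + 0 * R u n)"
      by (simp add: v_eq[abs_def])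
    also have "\<dots> = of_real s * ip \<beta> u a"
      by (subst ip_comb_right) (simp_all add: R_l2 a l2 ip_R)
    finally show ?thesis by (simp add: ip_cnj a l2)
  qed
  have T: "comp_op \<beta> \<Lambda> \<phi> (ser a) = ser (\<lambda>n. ip \<beta> a v * u n)" for a
  proof
    fix z
    have "dirichlet_series \<Lambda> (\<lambda>n. ip \<beta> a v * u n) z = ip \<beta> a v"
      unfolding dirichlet_series_def
      by (subst suminf_finite[of "{0}"]) (auto simp: u_def unit_seq_def \<Lambda>0)
    then show "comp_op \<beta> \<Lambda> \<phi> (ser a) z = ser (\<lambda>n. ip \<beta> a v * u n) z"
      using b \<phi> by (simp add: comp_op_def restr_H_def ser_def dirichlet_series_eq_ip v_def)
  qed
  define C where "C f = ser (R (coeffs_H \<beta> \<Lambda> f))" for f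
  have C: "C (ser a) = ser (R a)" if "a \<in> l2" for a
    by (simp add: C_def coeffs_ser that)
  have "conjugation \<beta> \<Lambda> C"
    by (rule conjugation_if_on_coeffs[where S = R, OF C R_l2 R_comb]) (simp_all add: ip_R R_R)
  moreover have "symmetric_wrt \<beta> \<Lambda> C (comp_op \<beta> \<Lambda> \<phi>)"
    unfolding symmetric_wrt_def space_H_eq
  proof clarify
    fix a assume a: "a \<in> l2"
    have mem: "(\<lambda>n. t * u n) \<in> l2" "(\<lambda>n. t * v n) \<in> l2" for t
      using l2 by (auto intro: l2_mult)
    have "R (\<lambda>n. ip \<beta> (R a) v * u n + 0 * u n) = (\<lambda>n. ip \<beta> a u * v n)"
      by (subst R_comb) (simp_all add: l2 ip_Rv a v_eq mult_ac)
    then have "C (comp_op \<beta> \<Lambda> \<phi> (C (ser a))) = ser (\<lambda>n. ip \<beta> a u * v n)"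
      by (simp add: C a T mem)
    also have "\<dots> = adjoint_H \<beta> \<Lambda> (comp_op \<beta> \<Lambda> \<phi>) (ser a)"
    proof (rule adjoint_eqI[where S = "\<lambda>a n. ip \<beta> a v * u n", OF T, symmetric])
      fix c assume c: "c \<in> l2"
      have "ip \<beta> (\<lambda>n. ip \<beta> c v * u n + 0 * u n) a = ip \<beta> c v * ip \<beta> u a"
        by (subst ip_comb_left) (simp_all add: l2 a)
      moreover have "ip \<beta> c (\<lambda>n. ip \<beta> a u * v n + 0 * v n) = ip \<beta> u a * ip \<beta> c v"
        by (subst ip_comb_right) (simp_all add: l2 a c ip_cnj)
      ultimately show "ip \<beta> (\<lambda>n. ip \<beta> c v * u n) a = ip \<beta> c (\<lambda>n. ip \<beta> a u * v n)"
        by simp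
    qed (simp_all add: mem a)
    finally show "C (comp_op \<beta> \<Lambda> \<phi> (C (ser a))) = adjoint_H \<beta> \<Lambda> (comp_op \<beta> \<Lambda> \<phi>) (ser a)" .
  qed
  ultimately show ?thesis
    unfolding complex_symmetric_def by blast
qed

end

section \<open>Complex symmetry of composition operators with affine symbols\<close>

theorem theorem6p12:
  fixes \<Lambda> \<beta> :: "nat \<Rightarrow> real" and \<phi> :: "complex \<Rightarrow> complex"
  assumes "strict_mono \<Lambda>" and "\<forall>n. 0 \<le> \<Lambda> n" and "filterlim \<Lambda> at_top sequentially"
    and "freq_growth \<Lambda> < \<infinity>"
    and "\<forall>n. 0 < \<beta> n"
    and "weight_growth \<beta> \<Lambda> \<noteq> \<infinity>" and "weight_growth \<beta> \<Lambda> \<noteq> - \<infinity>"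
    and "bounded_comp_op \<beta> \<Lambda> \<phi>"
  shows
    "(\<forall>b::complex. (\<forall>z\<in>dom_H \<beta> \<Lambda>. \<phi> z = z + b) \<longrightarrow>
        complex_symmetric \<beta> \<Lambda> (comp_op \<beta> \<Lambda> \<phi>) \<and>
        (\<forall>c::real. composition_conjugation \<beta> \<Lambda> (\<lambda>z. z + of_real c * \<i>) \<and>
           symmetric_wrt \<beta> \<Lambda> (J_op \<beta> \<Lambda> (\<lambda>z. z + of_real c * \<i>)) (comp_op \<beta> \<Lambda> \<phi>)))
     \<and> (\<forall>(a::real) (b::complex). a \<in> freq_ratios1 \<Lambda> \<longrightarrow>
        (\<forall>z\<in>dom_H \<beta> \<Lambda>. \<phi> z = of_real a * z + b) \<longrightarrow>
        \<not> complex_symmetric \<beta> \<Lambda> (comp_op \<beta> \<Lambda> \<phi>))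
     \<and> (\<forall>b::complex. \<Lambda> 0 = 0 \<longrightarrow> (\<forall>z\<in>dom_H \<beta> \<Lambda>. \<phi> z = b) \<longrightarrow>
        complex_symmetric \<beta> \<Lambda> (comp_op \<beta> \<Lambda> \<phi>))"
proof -
  interpret dirichlet_space \<Lambda> \<beta>
    using assms by unfold_locales auto
  have self: "\<phi> z \<in> dom_H \<beta> \<Lambda>" if "z \<in> dom_H \<beta> \<Lambda>" for z
    using assms(8) that by (auto simp: bounded_comp_op_def holo_self_map_def)
  show ?thesis
  proof (intro conjI allI impI)
    fix b :: complex and c :: real assume \<phi>: "\<forall>z\<in>dom_H \<beta> \<Lambda>. \<phi> z = z + b"
    show conj: "composition_conjugation \<beta> \<Lambda> (\<lambda>z. z + of_real c * \<i>)"
      by (rule J_translation_conjugation)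
    show sym: "symmetric_wrt \<beta> \<Lambda> (J_op \<beta> \<Lambda> (\<lambda>z. z + of_real c * \<i>)) (comp_op \<beta> \<Lambda> \<phi>)"
      using \<phi> self by (intro translation_symmetric) auto
    show "complex_symmetric \<beta> \<Lambda> (comp_op \<beta> \<Lambda> \<phi>)"
      using conj sym unfolding complex_symmetric_def composition_conjugation_def by blast
  next
    fix a :: real and b :: complex
    assume "a \<in> freq_ratios1 \<Lambda>" and "\<forall>z\<in>dom_H \<beta> \<Lambda>. \<phi> z = of_real a * z + b"
    then show "\<not> complex_symmetric \<beta> \<Lambda> (comp_op \<beta> \<Lambda> \<phi>)"
      using assms(8) by (intro dilation_not_complex_symmetric) auto
  next
    fix b :: complex assume "\<Lambda> 0 = 0" and \<phi>: "\<forall>z\<in>dom_H \<beta> \<Lambda>. \<phi> z = b"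
    moreover have "b \<in> dom_H \<beta> \<Lambda>"
      using dom_H_of_real \<phi> self by (metis gt_ex)
    ultimately show "complex_symmetric \<beta> \<Lambda> (comp_op \<beta> \<Lambda> \<phi>)"
      by (intro constant_complex_symmetric) auto
  qed
qed

end
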